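(* Let $(a_n)_{n\ge1}$, $(b_n)_{n\ge1}$ be sequences of positive integers and $\theta=\sum_{n=1}^{\infty}\frac{a_n}{b_n}$. Let $f$ be a function defined on the values $b_n$ with $f(b_n)>0$ for all $n$. Assume: (1) $b_1<b_2<\cdots$ and $b_n\mid b_{n+1}$ for all $n$; (2) $\frac{f(b_n)}{f(b_{n+1})}<\frac12$ for all sufficiently large $n$; (3) $\frac{f(b_n)}{b_{n+1}}a_{n+1}<\frac12$ for all sufficiently large $n$; (4) $\frac{b_n}{f(b_n)}\to0$ as $n\to\infty$. Then (i) $\theta$ is an irrational number; and (ii) there are infinitely many distinct fractions $\frac{c_n}{b_n}$, with $c_n$ integers, such that $\left|\theta-\frac{c_n}{b_n}\right|<\frac{1}{f(b_n)}$ (for all sufficiently large $n$). *)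

theory Defs
  imports Complex_Main
begin

end

theory Submission
  imports Defs
begin

text \<open>
  Since the denominators divide one another, the \<open>n\<close>-th partial sum is \<open>c n / b n\<close> for an integer
  \<open>c n\<close>. The two bounds by \<open>1/2\<close> make the terms telescope:
  \<open>a (n+1) / b (n+1) < 1 / (2 f (b n)) < 1 / f (b n) - 1 / f (b (n+1))\<close>, so the \<open>n\<close>-th tail lies
  strictly between \<open>0\<close> and \<open>1 / f (b n)\<close>. Hence \<open>b n \<theta> - c n\<close> is positive and tends to \<open>0\<close>, which is
  impossible for rational \<open>\<theta>\<close>; and the partial sums are distinct because the terms are positive.
\<close>

text \<open>A block of terms starting at \<open>n\<close> is at most \<open>u n - u (m + n)\<close>,
  and nonnegativity of \<open>u\<close> lets the second term be dropped. So the shifted partial sums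
  stay below \<open>u n\<close>, which gives both convergence and the tail estimate. Passing to the
  limit keeps only a weak inequality.\<close>

lemma summable_telescoping_bound:
  fixes t u :: "nat \<Rightarrow> real"
  assumes t_nonneg: "\<And>k. k \<ge> N \<Longrightarrow> 0 \<le> t k"
    and u_nonneg: "\<And>k. k \<ge> N \<Longrightarrow> 0 \<le> u k"
    and step: "\<And>k. k \<ge> N \<Longrightarrow> t k \<le> u k - u (Suc k)"
  shows "summable t" and "n \<ge> N \<Longrightarrow> suminf t - (\<Sum>k<n. t k) \<le> u n"
proof -
  have partial: "(\<Sum>k<m. t (k + n)) \<le> u n" if "n \<ge> N" for n m
  proof -
    have "(\<Sum>k<m. t (k + n)) \<le> (\<Sum>k<m. u (k + n) - u (Suc k + n))"
      using step that by (intro sum_mono) simp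
    also have "\<dots> = u n - u (m + n)"
      using sum_lessThan_telescope'[of "\<lambda>k. u (k + n)" m] by simp
    also have "\<dots> \<le> u n"
      using u_nonneg that by simp
    finally show ?thesis .
  qed
  have "summable (\<lambda>k. t (k + N))"
    using t_nonneg partial by (intro bounded_imp_summable[where B = "u N"])
      (simp_all del: sum.lessThan_Suc flip: lessThan_Suc_atMost)
  then show sum: "summable t"
    by (simp only: summable_iff_shift)
  assume "n \<ge> N"
  then have "(\<Sum>k. t (k + n)) \<le> u n"
    using sum partial by (intro suminf_le_const) (simp_all only: summable_iff_shift)
  then show "suminf t - (\<Sum>k<n. t k) \<le> u n"
    using suminf_minus_initial_segment[OF sum, of n] by simp
qed

text \<open>Rewriting \<open>c / b n\<close> over \<open>b (Suc n) = b n * d\<close> multiplies the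
  numerator by \<open>d\<close>; the new term then only adds \<open>a (Suc n)\<close> to it.\<close>

lemma sum_fractions_dvd_chain:
  fixes a b :: "nat \<Rightarrow> nat"
  assumes b_dvd: "\<And>n. n \<ge> 1 \<Longrightarrow> b n dvd b (Suc n)"
    and b_pos: "\<And>n. n \<ge> 1 \<Longrightarrow> b n > 0"
    and "n \<ge> 1"
  shows "\<exists>c :: int. (\<Sum>k<n. real (a (Suc k)) / real (b (Suc k))) = of_int c / real (b n)"
  using \<open>n \<ge> 1\<close>
proof (induction n rule: dec_induct)
  case base
  show ?case
    by (auto intro: exI[of _ "int (a 1)"])
next
  case (step n)
  then obtain c :: int
    where c: "(\<Sum>k<n. real (a (Suc k)) / real (b (Suc k))) = of_int c / real (b n)"
    by blast
  obtain d where d: "b (Suc n) = b n * d"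
    using b_dvd[OF step.hyps(1)] by blast
  have "d > 0" "b n > 0"
    using b_pos[of "Suc n"] d by simp_all
  then have "(\<Sum>k<Suc n. real (a (Suc k)) / real (b (Suc k)))
      = of_int (c * int d + int (a (Suc n))) / real (b (Suc n))"
    by (simp add: c d field_simps)
  then show ?case
    by blast
qed

text \<open>If \<theta> = p/q, every \<open>b n * \<theta> - c n\<close> is an integer multiple of
  1/q, so a nonzero one cannot be smaller than 1/q in absolute value.\<close>

lemma irrational_if_good_approximations:
  fixes \<theta> :: real and c :: "nat \<Rightarrow> int" and b :: "nat \<Rightarrow> nat"
  assumes nz: "\<forall>\<^sub>F n in sequentially. real (b n) * \<theta> \<noteq> of_int (c n)"
    and lim: "(\<lambda>n. real (b n) * \<theta> - of_int (c n)) \<longlonglongrightarrow> 0"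
  shows "\<theta> \<notin> \<rat>"
proof
  assume "\<theta> \<in> \<rat>"
  then obtain p q :: int where q: "q > 0" and \<theta>: "\<theta> = of_int p / of_int q"
    by (metis Rats_cases')
  have "\<forall>\<^sub>F n in sequentially. \<bar>real (b n) * \<theta> - of_int (c n)\<bar> < 1 / of_int q"
    using tendstoD[OF lim, of "1 / of_int q"] q by (simp add: dist_real_def)
  with nz have "\<forall>\<^sub>F n in sequentially. False"
  proof eventually_elim
    case (elim n)
    define z where "z = int (b n) * p - c n * q"
    have z: "real (b n) * \<theta> - of_int (c n) = of_int z / of_int q"
      using q by (simp add: z_def \<theta> field_simps)
    have "z \<noteq> 0"
      using elim(1) z by auto
    moreover have "\<bar>of_int z :: real\<bar> < 1"
      using elim(2) q unfolding z by (simp add: abs_divide divide_less_cancel)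
    ultimately show False
      by linarith
  qed
  then show False
    by simp
qed

theorem theorem6:
  fixes a b :: "nat \<Rightarrow> nat" and f :: "nat \<Rightarrow> real" and \<theta> :: real
  assumes a_pos: "\<And>n. n \<ge> 1 \<Longrightarrow> a n > 0"
    and b_pos: "\<And>n. n \<ge> 1 \<Longrightarrow> b n > 0"
    and theta: "\<theta> = (\<Sum>n. real (a (Suc n)) / real (b (Suc n)))"
    and f_pos: "\<And>n. n \<ge> 1 \<Longrightarrow> f (b n) > 0"
    and b_less: "\<And>n. n \<ge> 1 \<Longrightarrow> b n < b (Suc n)"
    and b_dvd: "\<And>n. n \<ge> 1 \<Longrightarrow> b n dvd b (Suc n)"
    and f_ratio: "\<forall>\<^sub>F n in sequentially. f (b n) / f (b (Suc n)) < 1 / 2"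
    and a_bound: "\<forall>\<^sub>F n in sequentially. f (b n) / real (b (Suc n)) * real (a (Suc n)) < 1 / 2"
    and lim: "(\<lambda>n. real (b n) / f (b n)) \<longlonglongrightarrow> 0"
  shows "\<theta> \<notin> \<rat> \<and>
    (\<exists>c :: nat \<Rightarrow> int.
       (\<forall>\<^sub>F n in sequentially. \<bar>\<theta> - of_int (c n) / real (b n)\<bar> < 1 / f (b n)) \<and>
       infinite {of_int (c n) / real (b n) | n.
         n \<ge> 1 \<and> \<bar>\<theta> - of_int (c n) / real (b n)\<bar> < 1 / f (b n)})"
proof -
  \<comment> \<open>The index is shifted: the sum of \<open>t k\<close> over \<open>k < n\<close>
    ends with \<open>a n / b n\<close>, so its common denominator is \<open>b n\<close>.\<close>
  define t where "t k = real (a (Suc k)) / real (b (Suc k))" for k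
  define u where "u n = 1 / f (b n)" for n
  have t_pos: "t k > 0" for k
    using a_pos b_pos by (simp add: t_def)
  obtain N where N1: "N \<ge> 1"
    and ratio: "\<And>n. n \<ge> N \<Longrightarrow> f (b n) / f (b (Suc n)) < 1 / 2"
    and bound: "\<And>n. n \<ge> N \<Longrightarrow> f (b n) / real (b (Suc n)) * real (a (Suc n)) < 1 / 2"
    using eventually_conj[OF eventually_ge_at_top[of 1] eventually_conj[OF f_ratio a_bound]]
    unfolding eventually_sequentially by (meson le_refl)
  have u_pos: "u n > 0" if "n \<ge> N" for n
    using f_pos that N1 by (simp add: u_def)
  have t_less: "t n < u n - u (Suc n)" if "n \<ge> N" for n
  proof -
    have F: "f (b n) > 0"
      using f_pos that N1 by simp
    \<comment> \<open>Scaling by \<open>f (b n)\<close> turns the two summands into exactly the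
      quantities that the hypotheses bound by 1/2.\<close>
    have "f (b n) * (t n + u (Suc n))
        = f (b n) / real (b (Suc n)) * real (a (Suc n)) + f (b n) / f (b (Suc n))"
      by (simp add: t_def u_def distrib_left)
    then have "f (b n) * (t n + u (Suc n)) < 1"
      using ratio[OF that] bound[OF that] by linarith
    then show ?thesis
      using F by (simp add: u_def field_simps)
  qed
  have summable: "summable t"
    and tail_le: "\<And>n. n \<ge> N \<Longrightarrow> \<theta> - (\<Sum>k<n. t k) \<le> u n"
    using summable_telescoping_bound[of N t u] t_pos u_pos t_less
    by (simp_all add: less_imp_le theta flip: t_def)
  have tail_pos: "\<theta> - (\<Sum>k<n. t k) > 0" for n
    using sum_less_suminf[OF summable] t_pos by (simp add: theta flip: t_def)
  \<comment> \<open>Strictness is recovered by splitting off one term: the tail at \<open>n\<close>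
    is \<open>t n\<close> plus the tail at \<open>Suc n\<close>, hence at most
    \<open>t n + u (Suc n)\<close>, which is below \<open>u n\<close>.\<close>
  have tail_less: "\<theta> - (\<Sum>k<n. t k) < u n" if "n \<ge> N" for n
    using tail_le[of "Suc n"] t_less[OF that] that by simp
  have "\<forall>n. \<exists>c :: int. n \<ge> 1 \<longrightarrow> (\<Sum>k<n. t k) = of_int c / real (b n)"
    using sum_fractions_dvd_chain[of b _ a] b_dvd b_pos unfolding t_def by blast
  then obtain c :: "nat \<Rightarrow> int"
    where c: "\<And>n. n \<ge> 1 \<Longrightarrow> (\<Sum>k<n. t k) = of_int (c n) / real (b n)"
    by metis
  have approx: "\<bar>\<theta> - of_int (c n) / real (b n)\<bar> < 1 / f (b n)" if "n \<ge> N" for n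
    using tail_pos[of n] tail_less[OF that] c[of n] that N1 by (simp add: u_def)
  have scaled: "real (b n) * \<theta> - of_int (c n) = real (b n) * (\<theta> - (\<Sum>k<n. t k))"
    if "n \<ge> N" for n
    using c[of n] b_pos[of n] that N1 by (simp add: field_simps)
  have "\<theta> \<notin> \<rat>"
  proof (rule irrational_if_good_approximations)
    have "real (b n) * \<theta> \<noteq> of_int (c n)" if "n \<ge> N" for n
      using scaled[OF that] tail_pos[of n] b_pos[of n] that N1 by auto
    then show "\<forall>\<^sub>F n in sequentially. real (b n) * \<theta> \<noteq> of_int (c n)"
      by (auto simp: eventually_sequentially)
    \<comment> \<open>By \<open>scaled\<close>, the left side is \<open>b n\<close> times a positive
      tail of size at most \<open>1 / f (b n)\<close>. The factor 1 matches \<open>K = 1\<close> in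
      \<open>tendsto_0_le\<close>.\<close>
    have "norm (real (b n) * \<theta> - of_int (c n)) \<le> norm (real (b n) / f (b n)) * 1" if "n \<ge> N" for n
      using mult_left_mono[OF tail_le[OF that], of "real (b n)"] scaled[OF that]
        tail_pos[of n] f_pos[of n] that N1 by (simp add: u_def abs_mult)
    then show "(\<lambda>n. real (b n) * \<theta> - of_int (c n)) \<longlonglongrightarrow> 0"
      by (intro tendsto_0_le[OF lim, where K = 1]) (auto simp: eventually_sequentially)
  qed
  moreover have "\<forall>\<^sub>F n in sequentially. \<bar>\<theta> - of_int (c n) / real (b n)\<bar> < 1 / f (b n)"
    using approx by (auto simp: eventually_sequentially)
  moreover have "infinite {of_int (c n) / real (b n) | n.
      n \<ge> 1 \<and> \<bar>\<theta> - of_int (c n) / real (b n)\<bar> < 1 / f (b n)}" (is "infinite ?A")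
  proof -
    have "strict_mono (\<lambda>n. \<Sum>k<n. t k)"
      using t_pos by (simp add: strict_mono_Suc_iff)
    \<comment> \<open>Strict growth makes the partial sums injective in \<open>n\<close>; the index
      range starts at \<open>N\<close> because \<open>approx\<close> holds from there on.\<close>
    then have "infinite ((\<lambda>n. \<Sum>k<n. t k) ` {N..})"
      by (metis finite_imageD infinite_Ici strict_mono_imp_inj_on inj_on_subset subset_UNIV)
    moreover have "(\<lambda>n. \<Sum>k<n. t k) ` {N..} \<subseteq> ?A"
      using approx c N1 by fastforce
    ultimately show ?thesis
      by (meson finite_subset)
  qed
  ultimately show ?thesis
    by blast
qed

end
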